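(* Let $h$ be a dimension function and let $\mathcal{P}$ be the family of non-constant polynomials in one variable with real coefficients (regarded as functions $\mathbb{R}\to\mathbb{R}$). Then there exists a perfect set $E\subseteq\mathbb{R}$ such that $\mathcal{H}^h(E)=0$ and $\bigcap_{1\le i\le n}P_i^{-1}(E)\neq\emptyset$ for any finite subset $\{P_1,\dots,P_n\}$ of $\mathcal{P}$; in particular, $E$ contains any finite polynomial pattern. Moreover, for a suitable choice of $h$ this yields a perfect set $E\subseteq\mathbb{R}$ of Hausdorff dimension zero that contains any finite polynomial pattern.
   Context: A dimension function is a function $h:\mathbb{R}_{\ge0}\to\mathbb{R}\cup\{+\infty\}$ that is non-decreasing and right continuous, with $h(0)=0$ and $h(t)>0$ for $t>0$. The associated (outer) Hausdorff measure is $\mathcal{H}^h(E)=\lim_{\delta\to0}\inf\{\sum_i h(|U_i|):\{U_i\}_i\text{ a (countable) }\delta\text{-covering of }E\}$, where $|U|$ is the diameter of $U$ and a $\delta$-covering is a covering by sets of diameter at most $\delta$. A set $E\subseteq\mathbb{R}$ contains the pattern $(f_i)_{i\in\Lambda}$ of functions $f_i:\mathbb{R}\to\mathbb{R}$ if there is $t\in\mathbb{R}$ with $f_i(t)\in E$ for all $i\in\Lambda$, equivalently $\bigcap_{i\in\Lambda}f_i^{-1}(E)\neq\emptyset$. The pattern is finite if $\Lambda$ is finite, and it is a polynomial pattern if all $f_i$ are non-constant polynomials. A perfect set is a closed set without isolated points. *)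

theory Defs
  imports "HOL-Analysis.Analysis" "HOL-Computational_Algebra.Polynomial"
begin

(* A non-decreasing function with h 0 = 0 is non-negative on {0..}, so ennreal covers all
   values allowed in \<real> \<union> {+\<infinity>}.  Values of h at negative arguments are irrelevant. *)
definition dimension_function :: "(real \<Rightarrow> ennreal) \<Rightarrow> bool" where
  "dimension_function h \<longleftrightarrow>
     mono_on {0..} h \<and> (\<forall>t\<ge>0. continuous (at_right t) h) \<and> h 0 = 0 \<and> (\<forall>t>0. 0 < h t)"

(* Boundedness is required explicitly because diameter is a real number, unspecified on
   unbounded sets.  Finite coverings are included: pad them with empty sets, which have
   diameter 0 and hence do not contribute to the sums below when h 0 = 0. *)
definition delta_covering :: "real \<Rightarrow> 'a::metric_space set \<Rightarrow> (nat \<Rightarrow> 'a set) \<Rightarrow> bool" where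
  "delta_covering \<delta> E U \<longleftrightarrow>
     E \<subseteq> (\<Union>i. U i) \<and> (\<forall>i. bounded (U i) \<and> diameter (U i) \<le> \<delta>)"

definition hausdorff_premeasure ::
    "(real \<Rightarrow> ennreal) \<Rightarrow> real \<Rightarrow> 'a::metric_space set \<Rightarrow> ennreal" where
  "hausdorff_premeasure h \<delta> E =
     (INF U\<in>{U. delta_covering \<delta> E U}. \<Sum>i. h (diameter (U i)))"

definition hausdorff_measure :: "(real \<Rightarrow> ennreal) \<Rightarrow> 'a::metric_space set \<Rightarrow> ennreal" where
  "hausdorff_measure h E = Lim (at_right 0) (\<lambda>\<delta>. hausdorff_premeasure h \<delta> E)"

lemma hausdorff_premeasure_antimono:
  assumes "\<delta> \<le> \<epsilon>"
  shows "hausdorff_premeasure h \<epsilon> E \<le> hausdorff_premeasure h \<delta> E"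
proof -
  have "delta_covering \<epsilon> E U" if "delta_covering \<delta> E U" for U
    using that assms unfolding delta_covering_def by (meson order_trans)
  then show ?thesis
    unfolding hausdorff_premeasure_def by (intro INF_superset_mono) auto
qed

(* The limit defining the Hausdorff measure always exists. *)
lemma hausdorff_premeasure_tendsto:
  "((\<lambda>\<delta>. hausdorff_premeasure h \<delta> E) \<longlongrightarrow> hausdorff_measure h E) (at_right 0)"
proof -
  define S where "S = (SUP \<delta>\<in>{0<..}. hausdorff_premeasure h \<delta> E)"
  have "((\<lambda>\<delta>. hausdorff_premeasure h \<delta> E) \<longlongrightarrow> S) (at_right 0)"
  proof (rule order_tendstoI)
    fix a assume "a < S"
    then obtain d where d: "d > 0" "a < hausdorff_premeasure h d E"
      unfolding S_def less_SUP_iff by auto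
    show "\<forall>\<^sub>F \<delta> in at_right 0. a < hausdorff_premeasure h \<delta> E"
      unfolding eventually_at_right_field
    proof (intro exI[of _ d] conjI allI impI)
      fix y assume "0 < y" "y < d"
      then show "a < hausdorff_premeasure h y E"
        using d(2) hausdorff_premeasure_antimono[of y d h E] by (simp add: less_le_trans)
    qed (fact d(1))
  next
    fix a assume a: "S < a"
    have "hausdorff_premeasure h y E < a" if "0 < y" for y
      using that a unfolding S_def
      by (meson SUP_upper greaterThan_iff le_less_trans)
    then show "\<forall>\<^sub>F \<delta> in at_right 0. hausdorff_premeasure h \<delta> E < a"
      unfolding eventually_at_right_field by (auto intro: exI[of _ 1])
  qed
  then show ?thesis
    unfolding hausdorff_measure_def by (metis tendsto_Lim trivial_limit_at_right_real)
qed

definition hausdorff_dimension :: "'a::metric_space set \<Rightarrow> ennreal" where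
  "hausdorff_dimension E =
     Inf {ennreal s | s. 0 < s \<and> hausdorff_measure (\<lambda>t. ennreal (t powr s)) E = 0}"

definition perfect_set :: "'a::topological_space set \<Rightarrow> bool" where
  "perfect_set E \<longleftrightarrow> closed E \<and> (\<forall>x\<in>E. \<not> x isolated_in E)"

definition nonconstant_polynomials :: "(real \<Rightarrow> real) set" where
  "nonconstant_polynomials = {poly p | p. degree p > 0}"

definition contains_pattern :: "real set \<Rightarrow> 'i set \<Rightarrow> ('i \<Rightarrow> real \<Rightarrow> real) \<Rightarrow> bool" where
  "contains_pattern E \<Lambda> f \<longleftrightarrow> (\<exists>t. \<forall>i\<in>\<Lambda>. f i t \<in> E)"

(* Finite families can always be indexed by natural numbers; a polymorphic index type would
   let E depend on that type. *)
definition contains_finite_polynomial_patterns :: "real set \<Rightarrow> bool" where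
  "contains_finite_polynomial_patterns E \<longleftrightarrow>
     (\<forall>(\<Lambda> :: nat set) f. finite \<Lambda> \<longrightarrow> (\<forall>i\<in>\<Lambda>. f i \<in> nonconstant_polynomials)
        \<longrightarrow> contains_pattern E \<Lambda> f)"

end

theory Submission
  imports Defs "HOL-Real_Asymp.Real_Asymp"
begin

text \<open>
  Let \<open>A\<^sub>k\<close> be a union of intervals of length \<open>\<delta>\<^sub>k\<^sub>+\<^sub>1\<close>, spaced \<open>e\<^sup>-\<^sup>k \<delta>\<^sub>k\<close> apart in \<open>[-e\<^sup>k, e\<^sup>k]\<close>,
  where \<open>\<delta>\<^sub>k\<^sub>+\<^sub>1\<close> is so small that \<open>h(\<delta>\<^sub>k\<^sub>+\<^sub>1)\<close> times the number of these intervals is at most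
  \<open>1/(k+1)\<close>. Partition the levels \<open>k\<close> into infinite classes \<open>S\<^sub>m \<subseteq> [m, \<infinity>)\<close>, and let
  \<open>D\<^sub>m\<close> be the set of those \<open>x\<close> with \<open>|x| \<ge> \<surd>m\<close> that lie in \<open>A\<^sub>k\<close> for all \<open>k \<in> S\<^sub>m\<close>.
  Each \<open>D\<^sub>m\<close> is closed and null, and the \<open>D\<^sub>m\<close> escape to infinity, so their union is closed and null.

  Assign to the polynomials \<open>P\<^sub>1, \<dots>, P\<^sub>n\<close> distinct indices \<open>m\<close> just above a large integer \<open>T\<close>. For
  \<open>t \<in> [T, T+1]\<close> the derivatives are bounded below by a constant and above by a small multiple of
  \<open>e\<^sup>T\<close>, so an interval of \<open>t\<close> of length comparable to \<open>\<delta>\<^sub>k\<close> is mapped onto an interval much longer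
  than \<open>e\<^sup>-\<^sup>k \<delta>\<^sub>k\<close>. Treating the levels \<open>k \<ge> T\<close> in turn, one can therefore shrink the \<open>t\<close>-interval so
  that the polynomial responsible for level \<open>k\<close> maps it into \<open>A\<^sub>k\<close>; the common point \<open>t\<close> satisfies
  \<open>P\<^sub>i(t) \<in> D\<^sub>m\<close>, \<open>m\<close> being the index of \<open>P\<^sub>i\<close>. Each step offers at least two disjoint choices, so
  \<open>t\<close> can also avoid any countable set. This allows the union to be replaced by the perfect set of
  its condensation points, which omits only countably many of its elements.
\<close>


section \<open>Null sets of the Hausdorff premeasure at a fixed scale\<close>

lemma premeasure_zeroI:
  assumes "\<And>\<epsilon>. \<epsilon> > 0 \<Longrightarrow> hausdorff_premeasure h \<delta> E \<le> ennreal \<epsilon>"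
  shows "hausdorff_premeasure h \<delta> E = 0"
  using ennreal_le_epsilon[of 0 "hausdorff_premeasure h \<delta> E"] assms by simp

lemma premeasure_zeroE:
  assumes "hausdorff_premeasure h \<delta> E = 0" "\<epsilon> > 0"
  obtains U where "delta_covering \<delta> E U" "(\<Sum>i. h (diameter (U i))) \<le> ennreal \<epsilon>"
proof -
  have "(INF U\<in>{U. delta_covering \<delta> E U}. \<Sum>i. h (diameter (U i))) < ennreal \<epsilon>"
    using assms unfolding hausdorff_premeasure_def by simp
  then show thesis
    using that unfolding INF_less_iff by (auto intro: less_imp_le)
qed

lemma premeasure_le_suminf:
  assumes "delta_covering \<delta> E U"
  shows "hausdorff_premeasure h \<delta> E \<le> (\<Sum>i. h (diameter (U i)))"
  unfolding hausdorff_premeasure_def using assms by (intro INF_lower) simp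

lemma premeasure_mono:
  assumes "A \<subseteq> B"
  shows "hausdorff_premeasure h \<delta> A \<le> hausdorff_premeasure h \<delta> B"
  unfolding hausdorff_premeasure_def
  using assms by (intro INF_superset_mono) (force simp: delta_covering_def)+

text \<open>The \<open>m\<close>-th set gets a covering of cost at most
  \<open>\<epsilon> / 2 ^ Suc m\<close>, and \<open>prod_decode\<close> merges these coverings into
  one sequence. Working at a fixed scale keeps the limit in \<open>\<delta>\<close> out of the
  argument.\<close>

lemma premeasure_UN_zero:
  fixes D :: "nat \<Rightarrow> 'a::metric_space set"
  assumes "\<And>m. hausdorff_premeasure h \<delta> (D m) = 0"
  shows "hausdorff_premeasure h \<delta> (\<Union>m. D m) = 0"
proof (rule premeasure_zeroI)
  fix \<epsilon> :: real
  assume \<epsilon>: "\<epsilon> > 0"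
  have "\<exists>U. delta_covering \<delta> (D m) U \<and> (\<Sum>i. h (diameter (U i))) \<le> ennreal (\<epsilon> * (1/2) ^ Suc m)" for m
    using premeasure_zeroE[OF assms, of "\<epsilon> * (1/2) ^ Suc m" m] \<epsilon> by auto
  then obtain U where U: "\<And>m. delta_covering \<delta> (D m) (U m)"
      "\<And>m. (\<Sum>i. h (diameter (U m i))) \<le> ennreal (\<epsilon> * (1/2) ^ Suc m)"
    by metis
  let ?V = "\<lambda>i. case prod_decode i of (m, n) \<Rightarrow> U m n"
  have "delta_covering \<delta> (\<Union>m. D m) ?V"
    unfolding delta_covering_def
  proof (intro conjI subsetI allI)
    fix x assume "x \<in> (\<Union>m. D m)"
    then obtain m n where "x \<in> U m n"
      using U(1) unfolding delta_covering_def by blast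
    then show "x \<in> (\<Union>i. ?V i)"
      by (intro UN_I[of "prod_encode (m, n)"]) simp_all
  qed (use U(1) in \<open>auto simp: delta_covering_def split: prod.splits\<close>)
  then have "hausdorff_premeasure h \<delta> (\<Union>m. D m) \<le> (\<Sum>i. h (diameter (?V i)))"
    by (rule premeasure_le_suminf)
  also have "\<dots> = (\<Sum>i. (\<lambda>(m, n). h (diameter (U m n))) (prod_decode i))"
    by (intro suminf_cong) (simp split: prod.splits)
  also have "\<dots> = (\<Sum>m. \<Sum>n. h (diameter (U m n)))"
    by (rule suminf_ennreal_2dimen) simp
  also have "\<dots> \<le> (\<Sum>m. ennreal (\<epsilon> * (1/2) ^ Suc m))"
    using U(2) by (intro suminf_le) auto
  also have "\<dots> = ennreal \<epsilon>"
  proof (rule suminf_ennreal_eq)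
    show "(\<lambda>m. \<epsilon> * (1/2) ^ Suc m) sums \<epsilon>"
      using sums_mult[OF power_half_series, of \<epsilon>] by simp
  qed (use \<epsilon> in simp)
  finally show "hausdorff_premeasure h \<delta> (\<Union>m. D m) \<le> ennreal \<epsilon>" .
qed

lemma premeasure_le_intervals:
  fixes c :: "nat \<Rightarrow> real"
  assumes "E \<subseteq> (\<Union>i<n. {c i..c i + d})" "0 \<le> d" "d \<le> \<delta>" "h 0 = 0"
  shows "hausdorff_premeasure h \<delta> E \<le> of_nat n * h d"
proof -
  \<comment> \<open>Padding with empty sets costs nothing because \<open>h 0 = 0\<close>.\<close>
  let ?U = "\<lambda>i. if i < n then {c i..c i + d} else {}"
  have "delta_covering \<delta> E ?U"
    unfolding delta_covering_def
  proof (intro conjI subsetI allI)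
    fix x assume "x \<in> E"
    then obtain i where "i < n" "x \<in> {c i..c i + d}"
      using subsetD[OF assms(1) \<open>x \<in> E\<close>] by (elim UN_E) simp
    then show "x \<in> (\<Union>i. ?U i)"
      by (intro UN_I[of i]) simp_all
  qed (use assms(2,3) in simp_all)
  then have "hausdorff_premeasure h \<delta> E \<le> (\<Sum>i. h (diameter (?U i)))"
    by (rule premeasure_le_suminf)
  also have "\<dots> = (\<Sum>i<n. h (diameter (?U i)))"
    by (intro suminf_finite) (simp_all add: assms(4))
  also have "\<dots> = of_nat n * h d"
    using assms(2) by simp
  finally show ?thesis .
qed

lemma premeasure_mono_fun:
  assumes "\<And>t. 0 \<le> t \<Longrightarrow> t \<le> \<delta> \<Longrightarrow> g t \<le> h t"
  shows "hausdorff_premeasure g \<delta> E \<le> hausdorff_premeasure h \<delta> E"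
  unfolding hausdorff_premeasure_def
proof (rule INF_mono)
  fix U assume "U \<in> {U. delta_covering \<delta> E U}"
  then show "\<exists>V\<in>{U. delta_covering \<delta> E U}. (\<Sum>i. g (diameter (V i))) \<le> (\<Sum>i. h (diameter (U i)))"
    using assms
    by (intro bexI[of _ U] suminf_le) (auto simp: delta_covering_def diameter_ge_0)
qed

text \<open>The limit at 0 only sees small scales. The threshold \<open>\<delta>\<^sub>0\<close>
  matters because two gauges may be comparable only near 0.\<close>

lemma hausdorff_measure_zeroI:
  assumes "\<And>\<delta>. 0 < \<delta> \<Longrightarrow> \<delta> < \<delta>\<^sub>0 \<Longrightarrow> hausdorff_premeasure h \<delta> E = 0" "\<delta>\<^sub>0 > 0"
  shows "hausdorff_measure h E = 0"
proof -
  have "\<forall>\<^sub>F \<delta> in at_right 0. hausdorff_premeasure h \<delta> E = 0"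
    using assms unfolding eventually_at_right_field by auto
  then have "((\<lambda>\<delta>. hausdorff_premeasure h \<delta> E) \<longlongrightarrow> 0) (at_right 0)"
    by (rule tendsto_eventually)
  then show ?thesis
    using hausdorff_premeasure_tendsto tendsto_unique trivial_limit_at_right_real by blast
qed

section \<open>The perfect kernel of a closed set\<close>

text \<open>\<open>K\<close> consists of the condensation points of \<open>E\<close>.\<close>

lemma perfect_kernel:
  fixes E :: "'a::second_countable_topology set"
  assumes "closed E"
  obtains K where "perfect_set K" "K \<subseteq> E" "countable (E - K)"
proof -
  define \<F> where "\<F> = {V. open V \<and> countable (E \<inter> V)}"
  \<comment> \<open>By Lindelof, countably many members of \<open>\<F>\<close> have the same union,
    so \<open>E\<close> meets that union in a countable set.\<close>
  obtain \<G> where \<G>: "\<G> \<subseteq> \<F>" "countable \<G>" "\<Union>\<G> = \<Union>\<F>"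
    using Lindelof[of \<F>] unfolding \<F>_def by blast
  have "countable (\<Union>V\<in>\<G>. E \<inter> V)"
    using \<G>(1,2) by (intro countable_UN) (auto simp: \<F>_def)
  also have "(\<Union>V\<in>\<G>. E \<inter> V) = E \<inter> \<Union>\<F>"
    using \<G>(3) by blast
  finally have countable: "countable (E \<inter> \<Union>\<F>)" .
  have "perfect_set (E - \<Union>\<F>)"
    unfolding perfect_set_def
  proof (intro conjI ballI notI)
    show "closed (E - \<Union>\<F>)"
      using assms by (intro closed_Diff open_Union) (auto simp: \<F>_def)
    fix x assume x: "x \<in> E - \<Union>\<F>" "x isolated_in E - \<Union>\<F>"
    then obtain T where T: "open T" "T \<inter> (E - \<Union>\<F>) = {x}"
      unfolding isolated_in_def by blast
    \<comment> \<open>A neighbourhood isolating \<open>x\<close> would meet \<open>E\<close> in a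
      countable set and hence belong to \<open>\<F>\<close>, although \<open>x\<close> lies outside
      the union of \<open>\<F>\<close>.\<close>
    then have "E \<inter> T \<subseteq> insert x (E \<inter> \<Union>\<F>)" by blast
    then have "countable (E \<inter> T)"
      by (rule countable_subset) (use countable in simp)
    then show False
      using x T by (auto simp: \<F>_def)
  qed
  moreover have "E - (E - \<Union>\<F>) = E \<inter> \<Union>\<F>" by blast
  ultimately show thesis
    using that[of "E - \<Union>\<F>"] countable by auto
qed

section \<open>Pulling grid intervals back along bi-Lipschitz functions\<close>

text \<open>The sign \<open>\<sigma>\<close> treats increasing and decreasing functions together; it
  is the same for all pairs of points.\<close>

definition bi_lipschitz_monotone :: "real \<Rightarrow> real \<Rightarrow> real set \<Rightarrow> (real \<Rightarrow> real) \<Rightarrow> bool" where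
  "bi_lipschitz_monotone a b S f \<longleftrightarrow> continuous_on S f \<and>
     (\<exists>\<sigma>\<in>{1, -1}. \<forall>s\<in>S. \<forall>t\<in>S. s \<le> t \<longrightarrow>
        a * (t - s) \<le> \<sigma> * (f t - f s) \<and> \<sigma> * (f t - f s) \<le> b * (t - s))"

lemma bi_lipschitz_monotone_subset:
  "bi_lipschitz_monotone a b S f \<Longrightarrow> T \<subseteq> S \<Longrightarrow> bi_lipschitz_monotone a b T f"
  unfolding bi_lipschitz_monotone_def by (meson continuous_on_subset subsetD)

text \<open>The end points come from the intermediate value theorem. The upper slope bound
  \<open>b\<close> keeps the preimage from being too short, which allows the construction to be
  iterated.\<close>

lemma preimage_interval_increasing:
  fixes f :: "real \<Rightarrow> real"
  assumes cont: "continuous_on {x..y} f" and "x \<le> y" "0 < a"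
    and bounds: "\<And>s t. x \<le> s \<Longrightarrow> s \<le> t \<Longrightarrow> t \<le> y \<Longrightarrow>
        a * (t - s) \<le> f t - f s \<and> f t - f s \<le> b * (t - s)"
    and "f x \<le> c" "c < d" "d \<le> f y"
  obtains x' y' where "x \<le> x'" "x' < y'" "y' \<le> y" "f ` {x'..y'} \<subseteq> {c..d}" "d - c \<le> b * (y' - x')"
proof -
  obtain x' where x': "x \<le> x'" "x' \<le> y" "f x' = c"
    using IVT'[of f x c y] assms by auto
  obtain y' where y': "x \<le> y'" "y' \<le> y" "f y' = d"
    using IVT'[of f x d y] assms by auto
  have mono: "f s \<le> f t" if "x \<le> s" "s \<le> t" "t \<le> y" for s t
    using bounds[of s t] that \<open>0 < a\<close> by (smt (verit) mult_nonneg_nonneg)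
  have "x' < y'"
    using mono[of y' x'] x' y' \<open>c < d\<close> by linarith
  moreover have "f ` {x'..y'} \<subseteq> {c..d}"
    using mono x' y' by fastforce
  ultimately show thesis
    using that x' y' bounds[of x' y'] by auto
qed

lemma preimage_interval:
  fixes f :: "real \<Rightarrow> real"
  assumes f: "bi_lipschitz_monotone a b {x..y} f" and "x \<le> y" "0 < a"
    and "min (f x) (f y) \<le> c" "c < d" "d \<le> max (f x) (f y)"
  obtains x' y' where "x \<le> x'" "x' < y'" "y' \<le> y" "f ` {x'..y'} \<subseteq> {c..d}" "d - c \<le> b * (y' - x')"
proof -
  obtain \<sigma> where \<sigma>: "\<sigma> \<in> {1, -1}" "\<And>s t. x \<le> s \<Longrightarrow> s \<le> t \<Longrightarrow> t \<le> y \<Longrightarrow>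
        a * (t - s) \<le> \<sigma> * (f t - f s) \<and> \<sigma> * (f t - f s) \<le> b * (t - s)"
    using f unfolding bi_lipschitz_monotone_def by fastforce
  have cont: "continuous_on {x..y} f"
    using f unfolding bi_lipschitz_monotone_def by blast
  have le: "0 \<le> \<sigma> * (f y - f x)"
    using \<sigma>(2)[of x y] \<open>x \<le> y\<close> \<open>0 < a\<close> by (smt (verit) mult_nonneg_nonneg)
  show thesis
  proof (cases "\<sigma> = 1")
    case True
    with le assms have "f x \<le> c" "d \<le> f y" by auto
    then show ?thesis
      using preimage_interval_increasing[OF cont \<open>x \<le> y\<close> \<open>0 < a\<close>, of b c d] \<sigma>(2) True \<open>c < d\<close> that
      by auto
  next
    case False
    with \<sigma>(1) have \<sigma>': "\<sigma> = -1" by simp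
    with le assms have *: "- f x \<le> - d" "- c \<le> - f y" by auto
    have "continuous_on {x..y} (\<lambda>t. - f t)"
      using cont by (intro continuous_intros)
    then obtain x' y' where "x \<le> x'" "x' < y'" "y' \<le> y" "(\<lambda>t. - f t) ` {x'..y'} \<subseteq> {-d..-c}"
        "- c - (- d) \<le> b * (y' - x')"
      using preimage_interval_increasing[of x y "\<lambda>t. - f t" a b "-d" "-c"]
        \<open>x \<le> y\<close> \<open>0 < a\<close> \<sigma>(2) \<sigma>' * \<open>c < d\<close> by auto
    then show ?thesis
      using that[of x' y'] by (auto simp: image_subset_iff)
  qed
qed

definition grid :: "real \<Rightarrow> real \<Rightarrow> real \<Rightarrow> real set" where
  "grid X r d = (\<Union>i<Suc (nat \<lceil>2 * X / r\<rceil>). {- X + real i * r .. - X + real i * r + d})"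

lemma closed_grid: "closed (grid X r d)"
  unfolding grid_def by (intro closed_UN) auto

text \<open>The values of \<open>f\<close> sweep out an interval of length at least
  \<open>4 * r\<close>, which contains two consecutive grid intervals. These are disjoint since
  \<open>d \<le> r / 2\<close>, so their preimages are too, and one of the preimages misses
  \<open>z\<close>.\<close>

lemma preimage_grid:
  fixes f :: "real \<Rightarrow> real"
  assumes f: "bi_lipschitz_monotone a b {x..y} f" and "x \<le> y" "0 < a"
    and X: "f ` {x..y} \<subseteq> {-X..X}" and d: "0 < d" "d \<le> r / 2"
    and r: "4 * r \<le> a * (y - x)"
  obtains x' y' where "x \<le> x'" "x' < y'" "y' \<le> y" "f ` {x'..y'} \<subseteq> grid X r d"
    "d \<le> b * (y' - x')" "z \<notin> {x'..y'}"
proof -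
  have "r > 0" using d by linarith
  define u v where "u = min (f x) (f y)" and "v = max (f x) (f y)"
  \<comment> \<open>\<open>c i\<close> is the first grid point at or above the smallest value
    \<open>u\<close>.\<close>
  define i where "i = nat \<lceil>(u + X) / r\<rceil>"
  define c where "c j = - X + real j * r" for j
  obtain \<sigma> where \<sigma>: "\<sigma> \<in> {1, -1}" "a * (y - x) \<le> \<sigma> * (f y - f x)"
    using f \<open>x \<le> y\<close> unfolding bi_lipschitz_monotone_def by fastforce
  have "\<sigma> * (f y - f x) \<le> v - u"
    using \<sigma>(1) by (auto simp: u_def v_def)
  with \<sigma>(2) r have uv: "u + 4 * r \<le> v" by linarith
  have bnd: "- X \<le> u" "v \<le> X"
    using X \<open>x \<le> y\<close> by (auto simp: u_def v_def image_subset_iff)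
  have "real i = of_int \<lceil>(u + X) / r\<rceil>"
    using bnd \<open>r > 0\<close> by (simp add: i_def)
  then have i: "(u + X) / r \<le> real i" "real i < (u + X) / r + 1"
    by linarith+
  have c: "u \<le> c i" "c i < u + r"
    using i \<open>r > 0\<close> by (auto simp: c_def field_simps)
  have c_Suc: "c (Suc i) = c i + r"
    by (simp add: c_def algebra_simps)
  \<comment> \<open>This keeps the index \<open>Suc i\<close> within the finite range of the
    grid.\<close>
  have "c (Suc i) \<le> X"
    using c c_Suc uv bnd \<open>r > 0\<close> by linarith
  then have "real (Suc i) \<le> 2 * X / r"
    using \<open>r > 0\<close> by (simp add: c_def field_simps)
  then have Suc_i: "Suc i \<le> nat \<lceil>2 * X / r\<rceil>"
    by linarith
  have sub: "{c j..c j + d} \<subseteq> grid X r d" if "j \<le> Suc i" for j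
    using that Suc_i unfolding grid_def c_def by (intro UN_upper) auto
  obtain x1 y1 where 1: "x \<le> x1" "x1 < y1" "y1 \<le> y" "f ` {x1..y1} \<subseteq> {c i..c i + d}"
      "(c i + d) - c i \<le> b * (y1 - x1)"
    using preimage_interval[OF f \<open>x \<le> y\<close> \<open>0 < a\<close>, of "c i" "c i + d"] c uv d
    unfolding u_def[symmetric] v_def[symmetric] by auto
  obtain x2 y2 where 2: "x \<le> x2" "x2 < y2" "y2 \<le> y" "f ` {x2..y2} \<subseteq> {c (Suc i)..c (Suc i) + d}"
      "(c (Suc i) + d) - c (Suc i) \<le> b * (y2 - x2)"
    using preimage_interval[OF f \<open>x \<le> y\<close> \<open>0 < a\<close>, of "c (Suc i)" "c (Suc i) + d"] c c_Suc uv d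
    unfolding u_def[symmetric] v_def[symmetric] by auto
  have "z \<notin> {x1..y1} \<or> z \<notin> {x2..y2}"
  proof (rule ccontr)
    assume "\<not> ?thesis"
    then have "f z \<le> c i + d" "c (Suc i) \<le> f z"
      using 1(4) 2(4) by (auto simp: image_subset_iff)
    then show False
      using c_Suc d by linarith
  qed
  then show thesis
  proof
    assume "z \<notin> {x1..y1}"
    with 1 sub[of i] show ?thesis by (intro that[of x1 y1]) auto
  next
    assume "z \<notin> {x2..y2}"
    with 2 sub[of "Suc i"] show ?thesis by (intro that[of x2 y2]) auto
  qed
qed

lemma premeasure_grid:
  assumes "0 \<le> d" "d \<le> \<delta>" "h 0 = 0"
  shows "hausdorff_premeasure h \<delta> (grid X r d) \<le> of_nat (Suc (nat \<lceil>2 * X / r\<rceil>)) * h d"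
  using assms by (intro premeasure_le_intervals[where c = "\<lambda>i. - X + real i * r"]) (auto simp: grid_def)

section \<open>The scales, the level sets and the layers\<close>

text \<open>The spacing at level \<open>k\<close> is \<open>exp (- real k) * \<delta> k\<close>. The
  second clause is the condition \<open>d \<le> r / 2\<close> of \<open>preimage_grid\<close>, and
  the third bounds the covering cost from \<open>premeasure_grid\<close>.\<close>

definition scale_sequence :: "(real \<Rightarrow> ennreal) \<Rightarrow> (nat \<Rightarrow> real) \<Rightarrow> bool" where
  "scale_sequence h \<delta> \<longleftrightarrow> \<delta> 0 = 1 \<and> (\<forall>k. 0 < \<delta> k \<and> \<delta> (Suc k) \<le> exp (- real k) * \<delta> k / 2 \<and>
     of_nat (Suc (nat \<lceil>2 * exp (real k) / (exp (- real k) * \<delta> k)\<rceil>)) * h (\<delta> (Suc k))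
       \<le> ennreal (1 / real (Suc k)))"

text \<open>Right continuity at 0 together with \<open>h 0 = 0\<close> makes \<open>h d\<close> tend
  to 0, so any fixed number of intervals can be made cheap.\<close>

lemma dimension_function_small:
  assumes "dimension_function h" "r > 0" "\<epsilon> > 0"
  obtains d where "0 < d" "d \<le> r" "of_nat (Suc n) * h d \<le> ennreal \<epsilon>"
proof -
  have "(h \<longlongrightarrow> 0) (at_right 0)"
    using assms(1) unfolding dimension_function_def continuous_within by force
  then have "\<forall>\<^sub>F d in at_right 0. h d < ennreal (\<epsilon> / real (Suc n))"
    using assms(3) by (intro order_tendstoD) auto
  then obtain b where b: "b > 0" "\<And>d. 0 < d \<Longrightarrow> d < b \<Longrightarrow> h d < ennreal (\<epsilon> / real (Suc n))"
    unfolding eventually_at_right_field by blast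
  define d where "d = min r (b / 2)"
  have "h d < ennreal (\<epsilon> / real (Suc n))"
    using b assms(2) by (auto simp: d_def)
  then have "of_nat (Suc n) * h d \<le> of_nat (Suc n) * ennreal (\<epsilon> / real (Suc n))"
    by (intro mult_left_mono) auto
  also have "\<dots> = ennreal (real (Suc n) * (\<epsilon> / real (Suc n)))"
    using assms(3) by (subst ennreal_mult) (auto simp: ennreal_of_nat_eq_real_of_nat simp del: of_nat_Suc)
  also have "\<dots> = ennreal \<epsilon>" by simp
  finally show thesis
    using that[of d] b assms(2) by (auto simp: d_def)
qed

lemma scale_sequence_exists:
  assumes "dimension_function h"
  obtains \<delta> where "scale_sequence h \<delta>"
proof -
  have "\<exists>\<delta>::nat \<Rightarrow> real. \<forall>k. (0 < \<delta> k \<and> (k = 0 \<longrightarrow> \<delta> k = 1)) \<and> (\<delta> (Suc k) \<le> exp (- real k) * \<delta> k / 2 \<and>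
     of_nat (Suc (nat \<lceil>2 * exp (real k) / (exp (- real k) * \<delta> k)\<rceil>)) * h (\<delta> (Suc k))
       \<le> ennreal (1 / real (Suc k)))"
  proof (rule dependent_nat_choice)
    fix x :: real and k :: nat
    assume "0 < x \<and> (k = 0 \<longrightarrow> x = 1)"
    then have "exp (- real k) * x / 2 > 0" "1 / real (Suc k) > 0" by auto
    from dimension_function_small[OF assms this, of "nat \<lceil>2 * exp (real k) / (exp (- real k) * x)\<rceil>"]
    show "\<exists>y. (0 < y \<and> (Suc k = 0 \<longrightarrow> y = 1)) \<and> (y \<le> exp (- real k) * x / 2 \<and>
      of_nat (Suc (nat \<lceil>2 * exp (real k) / (exp (- real k) * x)\<rceil>)) * h y
        \<le> ennreal (1 / real (Suc k)))"
      by (metis Zero_not_Suc)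
  qed (auto intro: exI[of _ 1])
  then show thesis
    using that unfolding scale_sequence_def by blast
qed

lemma scale_sequence_pos: "scale_sequence h \<delta> \<Longrightarrow> 0 < \<delta> k"
  and scale_sequence_Suc: "scale_sequence h \<delta> \<Longrightarrow> \<delta> (Suc k) \<le> exp (- real k) * \<delta> k / 2"
  by (simp_all add: scale_sequence_def)

lemma scale_sequence_le:
  assumes "scale_sequence h \<delta>"
  shows "\<delta> k \<le> (1 / 2) ^ k"
proof (induction k)
  case 0
  then show ?case using assms by (simp add: scale_sequence_def)
next
  case (Suc k)
  have "exp (- real k) * \<delta> k \<le> 1 * \<delta> k"
    using scale_sequence_pos[OF assms, of k] by (intro mult_right_mono) auto
  with Suc show ?case
    using scale_sequence_Suc[OF assms, of k] by simp
qed

definition level_set :: "(nat \<Rightarrow> real) \<Rightarrow> nat \<Rightarrow> real set" where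
  "level_set \<delta> k = grid (exp (real k)) (exp (- real k) * \<delta> k) (\<delta> (Suc k))"

text \<open>The levels \<^term>\<open>prod_encode (m, n)\<close>, all at least \<open>m\<close>, form the class \<open>S\<^sub>m\<close>.\<close>

definition layer :: "(nat \<Rightarrow> real) \<Rightarrow> nat \<Rightarrow> real set" where
  "layer \<delta> m = (\<Inter>n. level_set \<delta> (prod_encode (m, n))) \<inter> {x. sqrt (real m) \<le> \<bar>x\<bar>}"

lemma closed_layer: "closed (layer \<delta> m)"
proof -
  have "closed {x::real. sqrt (real m) \<le> \<bar>x\<bar>}"
    by (intro closed_Collect_le continuous_intros)
  then show ?thesis
    unfolding layer_def level_set_def by (intro closed_Int closed_INT) (auto intro: closed_grid)
qed

text \<open>The layer lies in a level set for each \<open>k\<close> of its infinite class, and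
  covering that level set costs at most \<open>1 / real (Suc k)\<close>.\<close>

lemma premeasure_layer:
  assumes \<delta>: "scale_sequence h \<delta>" and h: "dimension_function h" and "\<eta> > 0"
  shows "hausdorff_premeasure h \<eta> (layer \<delta> m) = 0"
proof (rule premeasure_zeroI)
  fix \<epsilon> :: real assume "\<epsilon> > 0"
  have "\<forall>\<^sub>F n in sequentially. (1/2) ^ n < \<eta>"
    using \<open>\<eta> > 0\<close> by (intro order_tendstoD(2)[OF LIMSEQ_power_zero]) auto
  moreover have "\<forall>\<^sub>F n in sequentially. 1 / real n < \<epsilon>"
    using \<open>\<epsilon> > 0\<close> by (intro order_tendstoD(2)[OF lim_1_over_n]) auto
  ultimately have "\<forall>\<^sub>F n in sequentially. (1/2) ^ n < \<eta> \<and> 1 / real n < \<epsilon>"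
    by eventually_elim simp
  then obtain N where N: "\<And>n. n \<ge> N \<Longrightarrow> (1/2) ^ n < \<eta> \<and> 1 / real n < \<epsilon>"
    unfolding eventually_sequentially by blast
  define k where "k = prod_encode (m, N)"
  have "N \<le> Suc k"
    using le_prod_encode_2[of N m] by (simp add: k_def)
  then have k: "(1/2) ^ Suc k < \<eta>" "1 / real (Suc k) < \<epsilon>"
    using N[of "Suc k"] by auto
  have "hausdorff_premeasure h \<eta> (layer \<delta> m) \<le> hausdorff_premeasure h \<eta> (level_set \<delta> k)"
    by (rule premeasure_mono) (auto simp: layer_def k_def)
  also have "\<dots> \<le> of_nat (Suc (nat \<lceil>2 * exp (real k) / (exp (- real k) * \<delta> k)\<rceil>)) * h (\<delta> (Suc k))"
    unfolding level_set_def
    using scale_sequence_pos[OF \<delta>, of "Suc k"] scale_sequence_le[OF \<delta>, of "Suc k"] k h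
    by (intro premeasure_grid) (auto simp: dimension_function_def)
  also have "\<dots> \<le> ennreal (1 / real (Suc k))"
    using \<delta> unfolding scale_sequence_def by blast
  also have "\<dots> \<le> ennreal \<epsilon>"
    using k by (intro ennreal_leI) simp
  finally show "hausdorff_premeasure h \<eta> (layer \<delta> m) \<le> ennreal \<epsilon>" .
qed

text \<open>A convergent sequence is bounded, so it stays in the union of finitely many
  \<open>D m\<close>.\<close>

lemma closed_UN_escaping:
  fixes D :: "nat \<Rightarrow> 'a::real_normed_vector set"
  assumes "\<And>m. closed (D m)" and R: "\<And>m x. x \<in> D m \<Longrightarrow> R m \<le> norm x"
    and "filterlim R at_top sequentially"
  shows "closed (\<Union>m. D m)"
  unfolding closed_sequential_limits
proof (intro allI impI, elim conjE)
  fix x l assume x: "\<forall>n. x n \<in> (\<Union>m. D m)" "x \<longlonglongrightarrow> l"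
  then obtain B where B: "\<And>n. norm (x n) \<le> B"
    using convergent_imp_bounded bounded_iff by (metis rangeI)
  have "\<forall>\<^sub>F m in sequentially. B < R m"
    using assms(3) by (simp add: filterlim_at_top_dense)
  then obtain N where N: "\<And>m. m \<ge> N \<Longrightarrow> B < R m"
    unfolding eventually_sequentially by blast
  have "\<forall>n. x n \<in> (\<Union>m<N. D m)"
  proof
    fix n
    obtain m where m: "x n \<in> D m" using x(1) by blast
    have "m < N"
      using R[OF m] B[of n] N[of m] by (cases "m < N") auto
    then show "x n \<in> (\<Union>m<N. D m)" using m by blast
  qed
  moreover have "closed (\<Union>m<N. D m)"
    using assms(1) by (intro closed_UN) auto
  ultimately have "l \<in> (\<Union>m<N. D m)"
    using x(2) closed_sequentially by metis
  then show "l \<in> (\<Union>m. D m)" by blast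
qed

lemma closed_UN_layer: "closed (\<Union>m. layer \<delta> m)"
proof (rule closed_UN_escaping)
  show "filterlim (\<lambda>m. sqrt (real m)) at_top sequentially"
    by (intro filterlim_compose[OF sqrt_at_top] filterlim_real_sequentially)
  show "sqrt (real m) \<le> norm x" if "x \<in> layer \<delta> m" for m x
    using that by (simp add: layer_def)
qed (rule closed_layer)

section \<open>The nested interval construction\<close>

text \<open>\<open>F k\<close> is the function responsible for level \<open>k\<close>, and
  \<open>z\<close> lists the points to avoid. Step \<open>j\<close> treats level
  \<open>T + j\<close> and excludes \<open>z j\<close>.\<close>

lemma nested_intervals_levels:
  fixes F :: "nat \<Rightarrow> real \<Rightarrow> real" and z :: "nat \<Rightarrow> real"
  assumes \<delta>: "scale_sequence h \<delta>" and "0 < a" "1 \<le> b" and ab: "4 * b \<le> a * exp (real T)"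
    and F: "\<And>k. bi_lipschitz_monotone a b {real T..real T + 1} (F k)"
    and F_bound: "\<And>k. F k ` {real T..real T + 1} \<subseteq> {- exp (real T)..exp (real T)}"
  obtains t where "t \<in> {real T..real T + 1}" "\<And>k. k \<ge> T \<Longrightarrow> F k t \<in> level_set \<delta> k" "t \<notin> range z"
proof -
  \<comment> \<open>The invariant: the current interval has length at least
    \<open>\<delta> (T + j) / b\<close>.\<close>
  define good where "good j J \<longleftrightarrow> real T \<le> fst J \<and> snd J \<le> real T + 1 \<and> \<delta> (T + j) \<le> b * (snd J - fst J)"
    for j and J :: "real \<times> real"
  define refines where "refines j J J' \<longleftrightarrow> {fst J'..snd J'} \<subseteq> {fst J..snd J} \<and>
      F (T + j) ` {fst J'..snd J'} \<subseteq> level_set \<delta> (T + j) \<and> z j \<notin> {fst J'..snd J'}"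
    for j and J J' :: "real \<times> real"
  have "\<exists>J. \<forall>j. good j (J j) \<and> refines j (J j) (J (Suc j))"
  proof (rule dependent_nat_choice)
    have "\<delta> T \<le> 1"
      using scale_sequence_le[OF \<delta>, of T] power_le_one[of "1/2::real" T] by linarith
    then have "good 0 (real T, real T + 1)"
      using \<open>1 \<le> b\<close> by (simp add: good_def)
    then show "\<exists>J. good 0 J" ..
  next
    fix J j assume J: "good j J"
    define k where "k = T + j"
    obtain x y where xy: "J = (x, y)" by fastforce
    have J': "real T \<le> x" "y \<le> real T + 1" "\<delta> k \<le> b * (y - x)"
      using J by (auto simp: good_def xy k_def)
    have pos: "0 < \<delta> k" "0 < \<delta> (Suc k)"
      using scale_sequence_pos[OF \<delta>] by auto
    have "0 < b * (y - x)" using pos J'(3) by linarith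
    then have "x \<le> y" using \<open>1 \<le> b\<close> by (simp add: zero_less_mult_iff)
    have exp_le: "exp (real T) \<le> exp (real k)" by (simp add: k_def)
    \<comment> \<open>Cancelling \<open>b\<close> from this chain gives the condition
      \<open>4 * r \<le> a * (y - x)\<close> of \<open>preimage_grid\<close> for the spacing
      \<open>r\<close> of level \<open>k\<close>.\<close>
    have "4 * b * \<delta> k \<le> a * exp (real k) * \<delta> k"
      using ab exp_le \<open>0 < a\<close> pos
      by (intro mult_right_mono) (auto intro: order_trans[OF _ mult_left_mono])
    also have "\<dots> \<le> a * exp (real k) * (b * (y - x))"
      using J'(3) \<open>0 < a\<close> by (intro mult_left_mono) auto
    finally have "4 * \<delta> k \<le> exp (real k) * (a * (y - x))"
      using \<open>1 \<le> b\<close> by (simp add: mult.assoc mult.left_commute)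
    then have r: "4 * (exp (- real k) * \<delta> k) \<le> a * (y - x)"
      by (simp add: exp_minus field_simps)
    have sub: "{x..y} \<subseteq> {real T..real T + 1}" using J' by auto
    have bnd: "F k ` {x..y} \<subseteq> {- exp (real k)..exp (real k)}"
    proof -
      have "F k ` {x..y} \<subseteq> F k ` {real T..real T + 1}"
        using sub by (rule image_mono)
      also note F_bound[of k]
      also have "{- exp (real T)..exp (real T)} \<subseteq> {- exp (real k)..exp (real k)}"
        using exp_le by auto
      finally show ?thesis .
    qed
    obtain x' y' where "x \<le> x'" "x' < y'" "y' \<le> y" "F k ` {x'..y'} \<subseteq> level_set \<delta> k"
      "\<delta> (Suc k) \<le> b * (y' - x')" "z j \<notin> {x'..y'}"
      using preimage_grid[OF bi_lipschitz_monotone_subset[OF F sub] \<open>x \<le> y\<close> \<open>0 < a\<close> bnd pos(2) _ r]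
        scale_sequence_Suc[OF \<delta>, of k] unfolding level_set_def by metis
    then show "\<exists>J'. good (Suc j) J' \<and> refines j J J'"
      using J' by (intro exI[of _ "(x', y')"]) (auto simp: good_def refines_def xy k_def)
  qed
  then obtain J where J: "\<And>j. good j (J j)" "\<And>j. refines j (J j) (J (Suc j))" by blast
  define I where "I j = {fst (J j)..snd (J j)}" for j
  have "\<Inter>(range I) \<noteq> {}"
  proof (rule compact_nest)
    fix j
    show "compact (I j)" by (simp add: I_def)
    have "0 < b * (snd (J j) - fst (J j))"
      using J(1)[of j] scale_sequence_pos[OF \<delta>, of "T + j"] by (auto simp: good_def)
    then show "I j \<noteq> {}"
      using \<open>1 \<le> b\<close> by (auto simp: I_def zero_less_mult_iff)
  next
    have "I (Suc j) \<subseteq> I j" for j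
      using J(2)[of j] unfolding I_def refines_def by blast
    then show "I n \<subseteq> I m" if "m \<le> n" for m n
      using that by (rule lift_Suc_antimono_le)
  qed
  then obtain t where t: "\<And>j. t \<in> I j" by blast
  show thesis
  proof (rule that)
    show "t \<in> {real T..real T + 1}"
      using t[of 0] J(1)[of 0] by (auto simp: I_def good_def)
    show "F k t \<in> level_set \<delta> k" if "k \<ge> T" for k
    proof -
      obtain j where k: "k = T + j" using le_Suc_ex[OF \<open>k \<ge> T\<close>] ..
      have "F (T + j) ` I (Suc j) \<subseteq> level_set \<delta> (T + j)"
        using J(2)[of j] by (simp add: I_def refines_def)
      then show ?thesis
        unfolding k using t[of "Suc j"] by (rule subsetD[OF _ imageI])
    qed
    show "t \<notin> range z"
    proof
      assume "t \<in> range z"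
      then obtain j where "t = z j" by blast
      then show False
        using t[of "Suc j"] J(2)[of j] by (simp add: I_def refines_def)
    qed
  qed
qed

section \<open>Growth of polynomials and their derivatives at infinity\<close>

lemma poly_eventually_ge_power:
  fixes q :: "real poly"
  assumes "q \<noteq> 0"
  shows "\<exists>\<sigma>\<in>{1, -1}. \<exists>c>0. \<forall>\<^sub>F t in at_top. c * t ^ degree q \<le> \<sigma> * poly q t"
  using assms
proof (induction q)
  case (pCons a q)
  show ?case
  proof (cases "q = 0")
    case True
    with pCons have "a \<noteq> 0" by auto
    then show ?thesis
      using True by (intro bexI[of _ "sgn a"] exI[of _ "\<bar>a\<bar>"]) (auto simp: sgn_real_def abs_real_def)
  next
    case False
    then obtain \<sigma> c where \<sigma>: "\<sigma> \<in> {1, -1}" and "c > 0"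
      and ev: "\<forall>\<^sub>F t in at_top. c * t ^ degree q \<le> \<sigma> * poly q t"
      using pCons by blast
    \<comment> \<open>Half of the leading growth is given up to absorb the constant term
      \<open>a\<close>.\<close>
    have "\<forall>\<^sub>F t in at_top. c / 2 * t ^ degree (pCons a q) \<le> \<sigma> * poly (pCons a q) t"
      using ev eventually_ge_at_top[of 1] eventually_ge_at_top[of "2 * \<bar>a\<bar> / c"]
    proof eventually_elim
      case (elim t)
      have "2 * \<bar>a\<bar> \<le> c * t"
        using elim(3) \<open>c > 0\<close> by (simp add: field_simps)
      also have "\<dots> \<le> c * t * t ^ degree q"
        using elim(2) \<open>c > 0\<close> one_le_power[of t "degree q"] by simp
      finally have "2 * \<bar>a\<bar> \<le> c * t ^ Suc (degree q)" by (simp add: mult.assoc)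
      moreover have "c * t ^ Suc (degree q) \<le> \<sigma> * (t * poly q t)"
        using mult_left_mono[OF elim(1), of t] elim(2) by (simp add: mult_ac)
      moreover have "- \<bar>a\<bar> \<le> \<sigma> * a" using \<sigma> by auto
      ultimately show ?case
        using False by (simp add: distrib_left)
    qed
    then show ?thesis
      using \<sigma> \<open>c > 0\<close> by (meson half_gt_zero)
  qed
qed simp

lemma poly_eventually_le_exp:
  fixes q :: "real poly"
  assumes "\<epsilon> > 0"
  shows "\<forall>\<^sub>F t in at_top. \<bar>poly q t\<bar> \<le> \<epsilon> * exp t"
proof -
  have "((\<lambda>t. \<Sum>i\<le>degree q. coeff q i * (t ^ i / exp t)) \<longlongrightarrow> (\<Sum>i\<le>degree q. coeff q i * 0)) at_top"
    by (intro tendsto_intros tendsto_power_div_exp_0)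
  then have "((\<lambda>t. poly q t / exp t) \<longlongrightarrow> 0) at_top"
    by (simp add: poly_altdef sum_divide_distrib)
  then have "\<forall>\<^sub>F t in at_top. \<bar>poly q t / exp t\<bar> < \<epsilon>"
    using assms by (simp add: tendsto_iff)
  then show ?thesis
    by eventually_elim (simp add: field_simps)
qed

text \<open>At least linear growth beats a square root whatever the leading coefficient. This is why
  the layers are cut off at \<open>sqrt (real m)\<close> rather than at
  \<open>real m\<close>.\<close>

lemma nonconstant_poly_eventually_ge_sqrt:
  fixes p :: "real poly"
  assumes "degree p > 0"
  shows "\<forall>\<^sub>F t in at_top. sqrt (t + x) \<le> \<bar>poly p t\<bar>"
proof -
  have "p \<noteq> 0" using assms by auto
  then obtain \<sigma> c where \<sigma>: "\<sigma> \<in> {1, -1}" and "c > 0"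
    and ev: "\<forall>\<^sub>F t in at_top. c * t ^ degree p \<le> \<sigma> * poly p t"
    using poly_eventually_ge_power by blast
  show ?thesis
    using ev eventually_ge_at_top[of 1] eventually_ge_at_top[of x] eventually_ge_at_top[of "2 / c\<^sup>2"]
  proof eventually_elim
    case (elim t)
    have "t + x \<le> 2 * t" using elim(3) by simp
    also have "\<dots> \<le> (c\<^sup>2 * t) * t"
      using elim(2,4) \<open>c > 0\<close> by (intro mult_right_mono) (auto simp: field_simps)
    also have "\<dots> = (c * t)\<^sup>2" by (simp add: power2_eq_square)
    finally have "sqrt (t + x) \<le> c * t"
      using \<open>c > 0\<close> elim(2) by (intro real_le_lsqrt) auto
    also have "\<dots> \<le> c * t ^ degree p"
      using \<open>c > 0\<close> elim(2) assms by (intro mult_left_mono self_le_power) auto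
    also have "\<dots> \<le> \<bar>poly p t\<bar>"
      using elim(1) \<sigma> by auto
    finally show ?case .
  qed
qed

lemma pderiv_eventually_bounded_away:
  fixes p :: "real poly"
  assumes "degree p > 0"
  shows "\<exists>\<sigma>\<in>{1, -1}. \<exists>c>0. \<forall>\<^sub>F t in at_top. c \<le> \<sigma> * poly (pderiv p) t"
proof -
  have "pderiv p \<noteq> 0" using assms by (simp add: pderiv_eq_0_iff)
  then obtain \<sigma> c where \<sigma>: "\<sigma> \<in> {1, -1}" and "c > 0"
    and ev: "\<forall>\<^sub>F t in at_top. c * t ^ degree (pderiv p) \<le> \<sigma> * poly (pderiv p) t"
    using poly_eventually_ge_power by blast
  have "\<forall>\<^sub>F t in at_top. c \<le> \<sigma> * poly (pderiv p) t"
    using ev eventually_ge_at_top[of 1]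
  proof eventually_elim
    case (elim t)
    have "c * 1 \<le> c * t ^ degree (pderiv p)"
      using \<open>c > 0\<close> elim(2) by (intro mult_left_mono one_le_power) auto
    with elim(1) show ?case by simp
  qed
  with \<sigma> \<open>c > 0\<close> show ?thesis by blast
qed

text \<open>By the mean value theorem, a difference quotient is a value of the derivative.\<close>

lemma bi_lipschitz_monotone_poly:
  fixes p :: "real poly"
  assumes \<sigma>: "\<sigma> \<in> {1, -1}"
    and bounds: "\<And>t. t \<in> {x..y} \<Longrightarrow> a \<le> \<sigma> * poly (pderiv p) t \<and> \<sigma> * poly (pderiv p) t \<le> b"
  shows "bi_lipschitz_monotone a b {x..y} (poly p)"
  unfolding bi_lipschitz_monotone_def
proof (intro conjI bexI[OF _ \<sigma>] ballI impI)
  show "continuous_on {x..y} (poly p)" by (intro continuous_intros)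
next
  fix s t assume st: "s \<in> {x..y}" "t \<in> {x..y}" "s \<le> t"
  obtain \<xi> where \<xi>: "\<xi> \<in> {x..y}" "poly p t - poly p s = (t - s) * poly (pderiv p) \<xi>"
  proof (cases "s = t")
    case True
    then show ?thesis using that[of s] st by simp
  next
    case False
    then obtain \<xi> where "s < \<xi>" "\<xi> < t" "poly p t - poly p s = (t - s) * poly (pderiv p) \<xi>"
      using poly_MVT[of s t p] st by auto
    then show ?thesis using that[of \<xi>] st by simp
  qed
  have eq: "\<sigma> * (poly p t - poly p s) = (\<sigma> * poly (pderiv p) \<xi>) * (t - s)"
    by (simp add: \<xi>(2))
  show "a * (t - s) \<le> \<sigma> * (poly p t - poly p s)" "\<sigma> * (poly p t - poly p s) \<le> b * (t - s)"
    unfolding eq using bounds[OF \<xi>(1)] st(3) by (auto intro: mult_right_mono)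
qed

section \<open>Finite polynomial patterns in the union of the layers\<close>

lemma layers_contain_patterns:
  assumes \<delta>: "scale_sequence h \<delta>" and Q: "finite Q" "Q \<subseteq> nonconstant_polynomials"
    and Z: "countable Z"
  obtains t where "t \<notin> Z" "\<And>P. P \<in> Q \<Longrightarrow> P t \<in> (\<Union>m. layer \<delta> m)"
proof (cases "Q = {}")
  case True
  have "Z \<noteq> UNIV" using Z uncountable_UNIV_real by metis
  with True show thesis using that by blast
next
  case False
  have "\<forall>P\<in>Q. \<exists>p \<sigma> c. P = poly p \<and> degree p > 0 \<and> \<sigma> \<in> {1, -1} \<and> c > 0 \<and>
      (\<forall>\<^sub>F t in at_top. c \<le> \<sigma> * poly (pderiv p) t)"
    using Q(2) pderiv_eventually_bounded_away unfolding nonconstant_polynomials_def by blast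
  then obtain p \<sigma> c where p: "\<And>P. P \<in> Q \<Longrightarrow> P = poly (p P)" "\<And>P. P \<in> Q \<Longrightarrow> degree (p P) > 0"
    and \<sigma>: "\<And>P. P \<in> Q \<Longrightarrow> \<sigma> P \<in> {1, -1}" and c: "\<And>P. P \<in> Q \<Longrightarrow> (c P :: real) > 0"
    and ev: "\<And>P. P \<in> Q \<Longrightarrow> \<forall>\<^sub>F t in at_top. c P \<le> \<sigma> P * poly (pderiv (p P)) t"
    by metis
  define a where "a = Min (c ` Q)"
  have a: "a > 0" "\<And>P. P \<in> Q \<Longrightarrow> a \<le> c P"
    using Q(1) False c by (auto simp: a_def)
  define n where "n = Max (to_nat_on Q ` Q)"
  have n: "to_nat_on Q P \<le> n" if "P \<in> Q" for P
    using that Q(1) by (auto simp: n_def)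
  \<comment> \<open>On \<open>{real T..real T + 1}\<close>, \<open>exp t\<close> is at most
    \<open>exp 1 * exp (real T)\<close>. The constants are divided by \<open>exp 1\<close> to give
    the slope bound \<open>b = a / 4 * exp (real T)\<close>, for which
    \<open>4 * b = a * exp (real T)\<close>, and the range bound \<open>exp (real T)\<close>. The
    summand \<open>n\<close> covers the indices \<open>m\<close> up to \<open>T + n\<close>.\<close>
  define good where "good P t \<longleftrightarrow> a \<le> \<sigma> P * poly (pderiv (p P)) t \<and>
      \<bar>poly (pderiv (p P)) t\<bar> \<le> a / (4 * exp 1) * exp t \<and>
      \<bar>P t\<bar> \<le> inverse (exp 1) * exp t \<and> sqrt (t + real n) \<le> \<bar>P t\<bar>" for P t
  have "\<forall>\<^sub>F t in at_top. good P t" if P: "P \<in> Q" for P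
  proof -
    have "\<forall>\<^sub>F t in at_top. \<bar>poly (pderiv (p P)) t\<bar> \<le> a / (4 * exp 1) * exp t"
      using a(1) by (intro poly_eventually_le_exp) auto
    moreover have "\<forall>\<^sub>F t in at_top. \<bar>P t\<bar> \<le> inverse (exp 1) * exp t"
      by (subst p(1)[OF P], rule poly_eventually_le_exp) auto
    moreover have "\<forall>\<^sub>F t in at_top. sqrt (t + real n) \<le> \<bar>P t\<bar>"
      by (subst p(1)[OF P], rule nonconstant_poly_eventually_ge_sqrt) (rule p(2)[OF P])
    ultimately show ?thesis
      using ev[OF P] by eventually_elim (use a(2)[OF P] in \<open>auto simp: good_def\<close>)
  qed
  then have "\<forall>\<^sub>F t in at_top. \<forall>P\<in>Q. good P t"
    using Q(1) by (simp add: eventually_ball_finite)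
  \<comment> \<open>This yields \<open>1 \<le> b\<close>.\<close>
  moreover have "\<forall>\<^sub>F t in at_top. 4 / a \<le> exp t"
    using exp_at_top by (simp add: filterlim_at_top)
  ultimately have "\<forall>\<^sub>F t in at_top. (\<forall>P\<in>Q. good P t) \<and> 4 / a \<le> exp t"
    by (rule eventually_conj)
  then obtain B where B: "\<And>t. t \<ge> B \<Longrightarrow> (\<forall>P\<in>Q. good P t) \<and> 4 / a \<le> exp t"
    unfolding eventually_at_top_linorder by blast
  obtain T :: nat where T: "B \<le> real T" using real_arch_simple by blast
  have exp_le: "exp t \<le> exp 1 * exp (real T)" if "t \<le> real T + 1" for t :: real
    using that by (simp add: exp_add[symmetric])
  define b where "b = a / 4 * exp (real T)"
  \<comment> \<open>Levels of class \<open>T + to_nat_on Q P\<close> go to \<open>P\<close>. Every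
    other level gets some element of \<open>Q\<close>, since \<open>from_nat_into\<close> never
    leaves a nonempty set.\<close>
  define F where "F k = from_nat_into Q (fst (prod_decode k) - T)" for k
  have F: "F k \<in> Q" for k
    using False by (simp add: F_def from_nat_into)
  have "1 \<le> b"
    using B[OF T] a(1) by (simp add: b_def field_simps)
  have bilip: "bi_lipschitz_monotone a b {real T..real T + 1} P" if P: "P \<in> Q" for P
  proof (subst p(1)[OF P], rule bi_lipschitz_monotone_poly[OF \<sigma>[OF P]])
    fix t assume t: "t \<in> {real T..real T + 1}"
    then have good: "good P t" using B T P by auto
    have "\<sigma> P * poly (pderiv (p P)) t \<le> \<bar>poly (pderiv (p P)) t\<bar>"
      using \<sigma>[OF P] by auto
    also have "\<dots> \<le> a / (4 * exp 1) * exp t"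
      using good by (simp add: good_def)
    also have "\<dots> \<le> a / (4 * exp 1) * (exp 1 * exp (real T))"
      using exp_le t a(1) by (intro mult_left_mono) auto
    finally show "a \<le> \<sigma> P * poly (pderiv (p P)) t \<and> \<sigma> P * poly (pderiv (p P)) t \<le> b"
      using good by (simp add: good_def b_def)
  qed
  have bound: "P ` {real T..real T + 1} \<subseteq> {- exp (real T)..exp (real T)}" if P: "P \<in> Q" for P
  proof (intro image_subsetI)
    fix t assume t: "t \<in> {real T..real T + 1}"
    then have "good P t" using B T P by auto
    then have "\<bar>P t\<bar> \<le> inverse (exp 1) * exp t" by (simp add: good_def)
    also have "\<dots> \<le> inverse (exp 1) * (exp 1 * exp (real T))"
      using exp_le t by (intro mult_left_mono) auto
    also have "\<dots> = exp (real T)" by simp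
    finally show "P t \<in> {- exp (real T)..exp (real T)}"
      by (auto simp: abs_le_iff)
  qed
  obtain t where t: "t \<in> {real T..real T + 1}" "\<And>k. k \<ge> T \<Longrightarrow> F k t \<in> level_set \<delta> k"
      "t \<notin> range (from_nat_into Z)"
    using nested_intervals_levels[where F = F and T = T and z = "from_nat_into Z",
        OF \<delta> a(1) \<open>1 \<le> b\<close> _ bilip[OF F] bound[OF F]]
    unfolding b_def by auto
  show thesis
  proof (rule that)
    show "t \<notin> Z" using t(3) subset_range_from_nat_into[OF Z] by blast
    fix P assume P: "P \<in> Q"
    define m where "m = T + to_nat_on Q P"
    have "P t \<in> level_set \<delta> (prod_encode (m, j))" for j
    proof -
      have "F (prod_encode (m, j)) = P"
        using Q(1) P by (simp add: F_def m_def countable_finite)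
      moreover have "prod_encode (m, j) \<ge> T"
        using le_prod_encode_1[of m j] by (simp add: m_def)
      ultimately show ?thesis using t(2) by metis
    qed
    moreover have "sqrt (real m) \<le> \<bar>P t\<bar>"
    proof -
      have "sqrt (real m) \<le> sqrt (t + real n)"
        using t(1) n[OF P] by (simp add: m_def)
      also have "\<dots> \<le> \<bar>P t\<bar>"
        using B[of t] T t(1) P by (auto simp: good_def)
      finally show ?thesis .
    qed
    ultimately show "P t \<in> (\<Union>m. layer \<delta> m)" unfolding layer_def by blast
  qed
qed

section \<open>Passing to the perfect kernel\<close>

lemma countable_poly_vimage:
  assumes "P \<in> nonconstant_polynomials" "countable C"
  shows "countable (P -` C)"
proof -
  obtain p where p: "P = poly p" "degree p > 0"
    using assms(1) unfolding nonconstant_polynomials_def by blast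
  have "finite {t. P t = y}" for y
  proof -
    have "p - [:y:] \<noteq> 0" using p(2) by auto
    then have "finite {t. poly (p - [:y:]) t = 0}" by (rule poly_roots_finite)
    then show ?thesis by (simp add: p(1))
  qed
  then have "countable (\<Union>y\<in>C. {t. P t = y})"
    using assms(2) by (intro countable_UN) (auto intro: countable_finite)
  also have "(\<Union>y\<in>C. {t. P t = y}) = P -` C" by auto
  finally show ?thesis .
qed

text \<open>Nullity is stated for premeasures at every scale, the form in which different gauges can
  be compared.\<close>

lemma perfect_null_set_containing_patterns:
  assumes h: "dimension_function h"
  obtains E :: "real set" where "perfect_set E" "\<And>\<eta>. \<eta> > 0 \<Longrightarrow> hausdorff_premeasure h \<eta> E = 0"
    "\<And>Q. finite Q \<Longrightarrow> Q \<subseteq> nonconstant_polynomials \<Longrightarrow> (\<Inter>P\<in>Q. P -` E) \<noteq> {}"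
proof -
  obtain \<delta> where \<delta>: "scale_sequence h \<delta>" using scale_sequence_exists[OF h] .
  obtain E where E: "perfect_set E" "E \<subseteq> (\<Union>m. layer \<delta> m)" "countable ((\<Union>m. layer \<delta> m) - E)"
    using perfect_kernel[OF closed_UN_layer] .
  show thesis
  proof (rule that[OF E(1)])
    fix \<eta> :: real assume "\<eta> > 0"
    then have "hausdorff_premeasure h \<eta> (\<Union>m. layer \<delta> m) = 0"
      by (intro premeasure_UN_zero premeasure_layer[OF \<delta> h])
    then show "hausdorff_premeasure h \<eta> E = 0"
      using premeasure_mono[OF E(2), of h \<eta>] by simp
  next
    fix Q :: "(real \<Rightarrow> real) set"
    assume Q: "finite Q" "Q \<subseteq> nonconstant_polynomials"
    \<comment> \<open>The kernel omits countably many points, and fibres of nonconstant polynomials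
      are finite, so only countably many \<open>t\<close> have to be avoided.\<close>
    have "countable (\<Union>P\<in>Q. P -` ((\<Union>m. layer \<delta> m) - E))"
      using Q E(3) by (intro countable_UN countable_poly_vimage) (auto intro: countable_finite)
    then obtain t where t: "t \<notin> (\<Union>P\<in>Q. P -` ((\<Union>m. layer \<delta> m) - E))"
        "\<And>P. P \<in> Q \<Longrightarrow> P t \<in> (\<Union>m. layer \<delta> m)"
      using layers_contain_patterns[OF \<delta> Q] by metis
    have "P t \<in> E" if "P \<in> Q" for P
    proof (rule ccontr)
      assume "P t \<notin> E"
      with t(2)[OF that] have "t \<in> P -` ((\<Union>m. layer \<delta> m) - E)" by simp
      with t(1) UN_I[OF that] show False by metis
    qed
    then show "(\<Inter>P\<in>Q. P -` E) \<noteq> {}"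
      unfolding ex_in_conv[symmetric] by (intro exI[of _ t]) simp
  qed
qed

lemma contains_finite_polynomial_patternsI:
  assumes "\<And>Q. finite Q \<Longrightarrow> Q \<subseteq> nonconstant_polynomials \<Longrightarrow> (\<Inter>P\<in>Q. P -` E) \<noteq> {}"
  shows "contains_finite_polynomial_patterns E"
  unfolding contains_finite_polynomial_patterns_def contains_pattern_def
proof (intro allI impI)
  fix \<Lambda> :: "nat set" and f :: "nat \<Rightarrow> real \<Rightarrow> real"
  assume "finite \<Lambda>" "\<forall>i\<in>\<Lambda>. f i \<in> nonconstant_polynomials"
  then have "(\<Inter>P\<in>f ` \<Lambda>. P -` E) \<noteq> {}"
    by (intro assms) auto
  then show "\<exists>t. \<forall>i\<in>\<Lambda>. f i t \<in> E" by auto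
qed

section \<open>A logarithmic gauge and Hausdorff dimension zero\<close>

text \<open>Near 0 this dominates every positive power of \<open>t\<close>. Using
  \<open>1 + 1 / t\<close> keeps the logarithm positive for all \<open>t > 0\<close>.\<close>

definition log_gauge :: "real \<Rightarrow> ennreal" where
  "log_gauge t = ennreal (1 / ln (1 + 1 / t))"

lemma ln_one_plus_inverse_pos: "t > 0 \<Longrightarrow> 0 < ln (1 + 1 / t :: real)"
  by (intro ln_gt_zero) simp

lemma dimension_function_log_gauge: "dimension_function log_gauge"
  unfolding dimension_function_def
proof (intro conjI allI impI)
  \<comment> \<open>Division by zero yields 0, so the formula reads
    \<open>1 / ln 1 = 1 / 0 = 0\<close>.\<close>
  show zero: "log_gauge 0 = 0" by (simp add: log_gauge_def)
  show "0 < log_gauge t" if "t > 0" for t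
    using ln_one_plus_inverse_pos[OF that] by (simp add: log_gauge_def)
  show "mono_on {0..} log_gauge"
  proof (rule mono_onI)
    fix s t :: real assume st: "s \<in> {0..}" "s \<le> t"
    show "log_gauge s \<le> log_gauge t"
    proof (cases "s = 0")
      case False
      then have "0 < s" using st by simp
      then have "ln (1 + 1 / t) \<le> ln (1 + 1 / s)"
        using st by (subst ln_le_cancel_iff) (auto simp: add_pos_pos frac_le)
      moreover have "0 < ln (1 + 1 / s)" "0 < ln (1 + 1 / t)"
        using \<open>0 < s\<close> st by (auto intro: ln_one_plus_inverse_pos)
      ultimately show ?thesis
        unfolding log_gauge_def by (intro ennreal_leI divide_left_mono mult_pos_pos) auto
    qed (simp add: zero)
  qed
  show "continuous (at_right t) log_gauge" if "0 \<le> t" for t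
  proof (cases "t = 0")
    case True
    have "((\<lambda>t::real. 1 / ln (1 + 1 / t)) \<longlongrightarrow> 0) (at_right 0)"
      by real_asymp
    then show ?thesis
      using tendsto_ennrealI zero unfolding continuous_within True log_gauge_def by fastforce
  next
    case False
    with that have "t > 0" by simp
    then have "isCont (\<lambda>t. 1 / ln (1 + 1 / t)) t"
      by (intro continuous_intros) (auto simp: add_pos_pos less_imp_neq[symmetric])
    then have "((\<lambda>t. 1 / ln (1 + 1 / t)) \<longlongrightarrow> 1 / ln (1 + 1 / t)) (at_right t)"
      unfolding isCont_def by (rule tendsto_mono[OF at_le, rotated]) simp
    then show ?thesis
      unfolding continuous_within log_gauge_def by (rule tendsto_ennrealI)
  qed
qed

lemma powr_le_log_gauge:
  assumes "s > 0"
  obtains d where "d > 0" "\<And>t. 0 \<le> t \<Longrightarrow> t < d \<Longrightarrow> ennreal (t powr s) \<le> log_gauge t"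
proof -
  have "((\<lambda>t. t powr s * ln (1 + 1 / t)) \<longlongrightarrow> 0) (at_right 0)"
    using assms by real_asymp
  then have "\<forall>\<^sub>F t in at_right 0. t powr s * ln (1 + 1 / t) < 1"
    by (rule order_tendstoD) simp
  then obtain d where d: "d > 0" "\<And>t. 0 < t \<Longrightarrow> t < d \<Longrightarrow> t powr s * ln (1 + 1 / t) < 1"
    unfolding eventually_at_right_field by blast
  show thesis
  proof (rule that[OF d(1)])
    fix t assume t: "0 \<le> t" "t < d"
    show "ennreal (t powr s) \<le> log_gauge t"
    proof (cases "t = 0")
      case False
      then have "0 < ln (1 + 1 / t)" using t by (intro ln_one_plus_inverse_pos) simp
      then show ?thesis
        unfolding log_gauge_def using d(2)[of t] t False
        by (intro ennreal_leI) (simp add: field_simps)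
    qed simp
  qed
qed

text \<open>At small scales each power \<open>t powr s\<close> with \<open>s > 0\<close> lies below
  \<open>log_gauge\<close>, so the measure vanishes for every \<open>s > 0\<close>.\<close>

lemma hausdorff_dimension_eq_0:
  assumes "\<And>\<eta>. \<eta> > 0 \<Longrightarrow> hausdorff_premeasure log_gauge \<eta> E = 0"
  shows "hausdorff_dimension E = 0"
proof -
  have null: "hausdorff_measure (\<lambda>t. ennreal (t powr s)) E = 0" if s: "s > 0" for s
  proof -
    obtain d where d: "d > 0" "\<And>t. 0 \<le> t \<Longrightarrow> t < d \<Longrightarrow> ennreal (t powr s) \<le> log_gauge t"
      using powr_le_log_gauge[OF s] by blast
    show ?thesis
    proof (rule hausdorff_measure_zeroI[OF _ d(1)])
      fix \<eta> assume \<eta>: "0 < \<eta>" "\<eta> < d"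
      then have "hausdorff_premeasure (\<lambda>t. ennreal (t powr s)) \<eta> E \<le> hausdorff_premeasure log_gauge \<eta> E"
        using d(2) by (intro premeasure_mono_fun) simp
      then show "hausdorff_premeasure (\<lambda>t. ennreal (t powr s)) \<eta> E = 0"
        using assms[OF \<eta>(1)] by simp
    qed
  qed
  have "hausdorff_dimension E \<le> ennreal s" if "s > 0" for s
    unfolding hausdorff_dimension_def using null[OF that] that by (intro Inf_lower) blast
  then show ?thesis
    using ennreal_le_epsilon[of 0 "hausdorff_dimension E"] by simp
qed

theorem theorem3p8:
  shows "(\<forall>h. dimension_function h \<longrightarrow>
           (\<exists>E :: real set. perfect_set E \<and> hausdorff_measure h E = 0
             \<and> (\<forall>Q. finite Q \<and> Q \<subseteq> nonconstant_polynomials \<longrightarrow> (\<Inter>P\<in>Q. P -` E) \<noteq> {})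
             \<and> contains_finite_polynomial_patterns E))
       \<and> (\<exists>h. dimension_function h \<and>
           (\<exists>E :: real set. perfect_set E \<and> hausdorff_measure h E = 0
             \<and> hausdorff_dimension E = 0
             \<and> contains_finite_polynomial_patterns E))"
proof (intro conjI allI impI)
  fix h :: "real \<Rightarrow> ennreal" assume "dimension_function h"
  then obtain E :: "real set" where E: "perfect_set E"
      "\<And>\<eta>. \<eta> > 0 \<Longrightarrow> hausdorff_premeasure h \<eta> E = 0"
      "\<And>Q. finite Q \<Longrightarrow> Q \<subseteq> nonconstant_polynomials \<Longrightarrow> (\<Inter>P\<in>Q. P -` E) \<noteq> {}"
    using perfect_null_set_containing_patterns by metis
  have "hausdorff_measure h E = 0"
    by (rule hausdorff_measure_zeroI[OF E(2), of 1]) auto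
  with E(1,3) contains_finite_polynomial_patternsI[OF E(3)]
  show "\<exists>E :: real set. perfect_set E \<and> hausdorff_measure h E = 0
      \<and> (\<forall>Q. finite Q \<and> Q \<subseteq> nonconstant_polynomials \<longrightarrow> (\<Inter>P\<in>Q. P -` E) \<noteq> {})
      \<and> contains_finite_polynomial_patterns E"
    by blast
next
  obtain E :: "real set" where E: "perfect_set E"
      "\<And>\<eta>. \<eta> > 0 \<Longrightarrow> hausdorff_premeasure log_gauge \<eta> E = 0"
      "\<And>Q. finite Q \<Longrightarrow> Q \<subseteq> nonconstant_polynomials \<Longrightarrow> (\<Inter>P\<in>Q. P -` E) \<noteq> {}"
    using perfect_null_set_containing_patterns[OF dimension_function_log_gauge] by metis
  have "hausdorff_measure log_gauge E = 0"
    by (rule hausdorff_measure_zeroI[OF E(2), of 1]) auto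
  with E(1) hausdorff_dimension_eq_0[OF E(2)] contains_finite_polynomial_patternsI[OF E(3)]
    dimension_function_log_gauge
  show "\<exists>h. dimension_function h \<and> (\<exists>E :: real set. perfect_set E \<and> hausdorff_measure h E = 0
      \<and> hausdorff_dimension E = 0 \<and> contains_finite_polynomial_patterns E)"
    by blast
qed

end
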